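(* Let $\gamma,\lambda>0$ and let $\rho_+=\frac{4(1-\gamma\lambda)+\gamma^2\lambda^2}{\gamma^2\lambda^2}$. For all $0<\epsilon\le 1/2$, $$\int_\epsilon^{1-\epsilon}\left|e^{-4\pi if}-e^{-2\pi if}(1-\gamma\lambda)\right|^{-2}df=\frac{\left[\arctan\left(\frac{\tan(x/2)}{\sqrt{\rho_+}}\right)\right]_{x=-\pi(1-2\epsilon)}^{x=\pi(1-2\epsilon)}}{\pi\gamma\lambda(2-\gamma\lambda)}.$$ From this it follows that, for stochastic gradient descent (SGD) with stepsize $\gamma$ under the zero-th order noise model with sampling with replacement (defined in the context), the quantities $$\rho_\pm^i=\frac{2+\gamma^2\lambda_i^2-2\gamma\lambda_i\pm2(1-\gamma\lambda_i)}{\gamma^2\lambda_i^2}$$ are $$\rho_+^i=\frac{4(1-\gamma\lambda_i)+\gamma^2\lambda_i^2}{\gamma^2\lambda_i^2},\qquad \rho_-^i=1,$$ and the stationary iterates $(x_k)_{k\in\mathbb{Z}}$ satisfy $$\mathrm{Tr}[\mathrm{Var}(x_k)]=\gamma\sum_{i=1}^d(u_i^\top\Sigma u_i)\frac{1}{\lambda_i(2-\gamma\lambda_i)}.$$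
   Context: Here $[F(x)]_{x=a}^{x=b}=F(b)-F(a)$; in the integrand $i$ is the imaginary unit, elsewhere it is an index. The quantities $\rho_\pm^i$ are the values at $\alpha=0$, $\lambda=\lambda_i$ of the parameters $\rho_\pm=\frac{2(1-\alpha)^2+\gamma^2\lambda^2-2(1+\alpha)\gamma\lambda\pm2(1-\alpha)\sqrt{(1-\alpha)^2+\gamma^2\lambda^2-2(1+\alpha)\gamma\lambda}}{\gamma^2\lambda^2}$ used for SGD with momentum $\alpha$, with $\sqrt{(1-\gamma\lambda)^2}$ written as $1-\gamma\lambda$. Let $A_1,\dots,A_n\in\mathbb{R}^{d\times d}$ be symmetric and $b_1,\dots,b_n\in\mathbb{R}^d$; put $A=\frac1n\sum_i A_i$, assumed strictly positive definite, $b=\frac1n\sum_i b_i$, $x^\star=-A^{-1}b$, $y_i=-A_iA^{-1}b+b_i$ (so $\sum_i y_i=0$), $\Sigma=\frac1n\sum_{i=1}^n y_iy_i^\top$. Let $(u_i)_{i=1}^d$ be an orthonormal basis of eigenvectors of $A$, $Au_i=\lambda_iu_i$, $\lambda_i>0$. Zero-th order noise model: the gradient of $f_i(x)=\frac12x^\top A_ix+b_i^\top x$ is replaced by $\widehat{\nabla f_i}(x)=Ax+y_i+b$. SGD: $x_{k+1}=x_k-\gamma\widehat{\nabla f_{i_k}}(x_k)$; equivalently, with $\Delta x_k=x_k-x^\star$, $\Delta x_{k+1}=(\mathrm{Id}-\gamma A)\Delta x_k-\gamma y_{i_k}$. Sampling with replacement: $(i_k)_{k\in\mathbb{Z}}$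 i.i.d. uniform on $\{1,\dots,n\}$. Stationary iterates: $(\Delta x_k)_k$ is the output of the linear time-invariant system with input $(y_{i_k})_k$ defined by this recursion, i.e. $\Delta x_k=\sum_{j\in\mathbb{Z}}H_{k-j}y_{i_j}$, where $(H_k)_{k\in\mathbb{Z}}$ are the matrices with $\sum_kH_kz^{-k}=H(z):=-\gamma(z\mathrm{Id}-\mathrm{Id}+\gamma A)^{-1}$ for $|z|=1$.
   Formalization: The integral formula is stated only for γλ<2 and the variance formula only when γλ_i<2 for all i; for γλ>2 (ε<1/2, nonzero noise in such directions) the right-hand side has the wrong sign, and at γλ=2 it is undefined. *)

theory Defs
  imports "HOL-Probability.Probability"
begin

text \<open>The quadratic problem, with data \<open>A 1, \<dots>, A n\<close> and \<open>b 1, \<dots>, b n\<close>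
  (values at other indices are ignored).\<close>

definition avg :: "nat \<Rightarrow> (nat \<Rightarrow> 'a) \<Rightarrow> 'a::real_vector" where
  "avg n v = (1 / real n) *\<^sub>R (\<Sum>i=1..n. v i)"

definition outer :: "real^'m \<Rightarrow> real^'n \<Rightarrow> real^'n^'m" where
  "outer v w = (\<chi> r c. v $ r * w $ c)"

definition optimum :: "nat \<Rightarrow> (nat \<Rightarrow> real^'d^'d) \<Rightarrow> (nat \<Rightarrow> real^'d) \<Rightarrow> real^'d" where
  "optimum n A b = - (matrix_inv (avg n A) *v avg n b)"

definition noise ::
    "nat \<Rightarrow> (nat \<Rightarrow> real^'d^'d) \<Rightarrow> (nat \<Rightarrow> real^'d) \<Rightarrow> nat \<Rightarrow> real^'d" where
  "noise n A b i = - (A i *v (matrix_inv (avg n A) *v avg n b)) + b i"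

definition noise_cov ::
    "nat \<Rightarrow> (nat \<Rightarrow> real^'d^'d) \<Rightarrow> (nat \<Rightarrow> real^'d) \<Rightarrow> real^'d^'d" where
  "noise_cov n A b = avg n (\<lambda>i. outer (noise n A b i) (noise n A b i))"

text \<open>The zero-th order noise model: the gradient \<open>A i *v x + b i\<close> of
  \<open>x \<bullet> (A i *v x) / 2 + b i \<bullet> x\<close> is replaced by the following vector.\<close>

definition zeroth_order_grad ::
    "nat \<Rightarrow> (nat \<Rightarrow> real^'d^'d) \<Rightarrow> (nat \<Rightarrow> real^'d) \<Rightarrow> nat \<Rightarrow> real^'d \<Rightarrow> real^'d" where
  "zeroth_order_grad n A b i x = avg n A *v x + noise n A b i + avg n b"

definition transfer_function :: "real \<Rightarrow> real^'d^'d \<Rightarrow> complex \<Rightarrow> complex^'d^'d" where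
  "transfer_function \<gamma> A z =
     - \<gamma> *\<^sub>R matrix_inv (mat z - mat 1 + \<gamma> *\<^sub>R map_matrix complex_of_real A)"

text \<open>The two-sided sequence whose z-transform is the transfer function on the unit circle.
  Convergence is unconditional, hence absolute, so there is at most one such sequence; there is
  one whenever the transfer function has no pole on the unit circle.\<close>

definition impulse_response :: "real \<Rightarrow> real^'d^'d \<Rightarrow> int \<Rightarrow> real^'d^'d" where
  "impulse_response \<gamma> A = (THE H. \<forall>z. cmod z = 1 \<longrightarrow>
     ((\<lambda>k. map_matrix (\<lambda>h. complex_of_real h * z powi (- k)) (H k))
        has_sum transfer_function \<gamma> A z) UNIV)"

text \<open>Here \<open>J k \<omega>\<close> is the index sampled at time \<open>k\<close>.\<close>

definition stationary_iterate ::
    "real \<Rightarrow> nat \<Rightarrow> (nat \<Rightarrow> real^'d^'d) \<Rightarrow> (nat \<Rightarrow> real^'d) \<Rightarrow> (int \<Rightarrow> 'w \<Rightarrow> nat)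
      \<Rightarrow> int \<Rightarrow> 'w \<Rightarrow> real^'d" where
  "stationary_iterate \<gamma> n A b J k \<omega> =
     optimum n A b
     + (\<Sum>\<^sub>\<infinity>j\<in>UNIV. impulse_response \<gamma> (avg n A) (k - j) *v noise n A b (J j \<omega>))"

definition Var :: "'w measure \<Rightarrow> ('w \<Rightarrow> real^'d) \<Rightarrow> real^'d^'d" where
  "Var M X = (\<integral>\<omega>. outer (X \<omega> - (\<integral>\<omega>'. X \<omega>' \<partial>M)) (X \<omega> - (\<integral>\<omega>'. X \<omega>' \<partial>M)) \<partial>M)"

text \<open>The parameters for SGD with momentum \<open>\<alpha>\<close>. The argument \<open>r\<close> is the chosen
  square root of the discriminant: at \<open>\<alpha> = 0\<close> the discriminant is \<open>(1 - \<gamma> * l)\<^sup>2\<close> and the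
  root used is \<open>1 - \<gamma> * l\<close>, also when this is negative.\<close>

definition momentum_discriminant :: "real \<Rightarrow> real \<Rightarrow> real \<Rightarrow> real" where
  "momentum_discriminant \<alpha> \<gamma> l = (1 - \<alpha>)\<^sup>2 + \<gamma>\<^sup>2 * l\<^sup>2 - 2 * (1 + \<alpha>) * \<gamma> * l"

definition rho_plus :: "real \<Rightarrow> real \<Rightarrow> real \<Rightarrow> real \<Rightarrow> real" where
  "rho_plus \<alpha> \<gamma> l r =
     (2 * (1 - \<alpha>)\<^sup>2 + \<gamma>\<^sup>2 * l\<^sup>2 - 2 * (1 + \<alpha>) * \<gamma> * l + 2 * (1 - \<alpha>) * r) / (\<gamma>\<^sup>2 * l\<^sup>2)"

definition rho_minus :: "real \<Rightarrow> real \<Rightarrow> real \<Rightarrow> real \<Rightarrow> real" where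
  "rho_minus \<alpha> \<gamma> l r =
     (2 * (1 - \<alpha>)\<^sup>2 + \<gamma>\<^sup>2 * l\<^sup>2 - 2 * (1 + \<alpha>) * \<gamma> * l - 2 * (1 - \<alpha>) * r) / (\<gamma>\<^sup>2 * l\<^sup>2)"

end

(* In the eigenbasis u of A the system decouples into scalar autoregressions with coefficients
   a_i = 1 - gamma * lam i, and gamma * lam i < 2 says |a_i| < 1. The causal geometric sequence
   - gamma * a_i^(k-1), k >= 1, has z-transform - gamma / (z - a_i) on the unit circle and is the only
   such sequence, so the i-th coordinate of the stationary error is - gamma times the discounted sum of
   the past noises u i . y. The noises are centred and orthogonal in L2, so its variance is
   gamma^2 * (u i . Sigma u i) / (1 - a_i^2), and 1 - a_i^2 = gamma * lam i * (2 - gamma * lam i).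
   The integral formula is the substitution t = tan (pi * f - pi / 2). The variance is not derived from
   it: with the discounted sum no limit epsilon -> 0 is needed. *)

theory Submission
  imports Defs
begin

subsection \<open>The integral of the squared modulus\<close>

text \<open>Here \<open>a\<close> stands for \<open>1 - \<gamma> * l\<close>, and
  \<open>(1 + a) / (1 - a)\<close> is the square root of \<rho>. For \<open>f\<close> in (0,1) the
  angle \<open>pi * f - pi / 2\<close> stays strictly between the poles of \<open>tan\<close>, so
  the arctangent is a primitive without branch jumps; \<open>0 < e\<close> keeps the interval of
  integration inside (0,1).\<close>

lemma has_integral_inverse_square_modulus:
  fixes a e :: real
  assumes a: "\<bar>a\<bar> < 1" and e: "0 < e" "e \<le> 1/2"
  defines "F \<equiv> \<lambda>x. arctan (tan (x / 2) / ((1 + a) / (1 - a)))"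
  shows "((\<lambda>f. cmod (exp (- 4 * pi * \<i> * of_real f) - exp (- 2 * pi * \<i> * of_real f) * of_real a) powi (- 2))
      has_integral ((F (pi * (1 - 2 * e)) - F (- pi * (1 - 2 * e))) / (pi * (1 - a\<^sup>2)))) {e..1 - e}"
    (is "(?g has_integral _) _")
proof -
  define q where "q = (1 - a) / (1 + a)"
  define G where "G = (\<lambda>f. arctan (tan (pi * f - pi / 2) * q) / (pi * (1 - a\<^sup>2)))"
  have a_pos: "1 + a > 0" "1 - a > 0" using a by auto
  have a2: "1 - a\<^sup>2 = (1 - a) * (1 + a)" by (simp add: power2_eq_square algebra_simps)
  have integrand: "?g f = 1 / (1 + a\<^sup>2 - 2 * a * cos (2 * pi * f))" for f
  proof -
    \<comment> \<open>A unimodular factor drops out, leaving the squared distance from a point of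
      the unit circle to \<open>a\<close>.\<close>
    have "exp (- 4 * pi * \<i> * of_real f) - exp (- 2 * pi * \<i> * of_real f) * of_real a
        = cis (- 2 * pi * f) * (cis (- 2 * pi * f) - of_real a)"
      by (simp add: cis_conv_exp right_diff_distrib flip: exp_add) (simp add: algebra_simps)
    then have "(cmod (exp (- 4 * pi * \<i> * of_real f) - exp (- 2 * pi * \<i> * of_real f) * of_real a))\<^sup>2
        = (cmod (cis (- 2 * pi * f) - of_real a))\<^sup>2"
      by (simp add: norm_mult)
    also have "\<dots> = (cos (2 * pi * f) - a)\<^sup>2 + (sin (2 * pi * f))\<^sup>2"
      by (simp add: cmod_power2)
    also have "\<dots> = 1 + a\<^sup>2 - 2 * a * cos (2 * pi * f)"
      using sin_cos_squared_add[of "2 * pi * f"] by (simp add: power2_eq_square algebra_simps)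
    finally show ?thesis
      by (simp add: power_int_minus field_simps)
  qed
  have deriv: "(G has_real_derivative ?g f) (at f within {e..1 - e})" if "f \<in> {e..1 - e}" for f
  proof -
    define \<theta> where "\<theta> = pi * f - pi / 2"
    have f: "0 < f" "f < 1" using that e by auto
    have "pi * f < pi * 1" using f by (intro mult_strict_left_mono) auto
    then have "\<bar>\<theta>\<bar> < pi / 2" using f by (auto simp: \<theta>_def abs_if)
    then have c: "cos \<theta> > 0" by (intro cos_gt_zero_pi) auto
    \<comment> \<open>The shift of \<theta> by a quarter turn becomes a half turn after doubling,
      hence the sign.\<close>
    have cos2: "cos (2 * pi * f) = - (2 * (cos \<theta>)\<^sup>2 - 1)"
    proof -
      have "cos (2 * pi * f) = cos (2 * \<theta> + pi)" by (simp add: \<theta>_def algebra_simps)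
      then show ?thesis by (simp add: cos_double_cos)
    qed
    have s: "(sin \<theta>)\<^sup>2 = 1 - (cos \<theta>)\<^sup>2" by (simp add: sin_squared_eq)
    have pos: "(1 + a)\<^sup>2 * (cos \<theta>)\<^sup>2 + (1 - a)\<^sup>2 * (sin \<theta>)\<^sup>2 > 0"
      using c a_pos by (intro add_pos_nonneg) auto
    have "(G has_real_derivative
        (inverse ((cos \<theta>)\<^sup>2) * pi * q * inverse (1 + (tan \<theta> * q)\<^sup>2)) / (pi * (1 - a\<^sup>2))) (at f within {e..1 - e})"
      unfolding G_def using c a_pos
      by (auto intro!: derivative_eq_intros simp: \<theta>_def a2)
    also have "(inverse ((cos \<theta>)\<^sup>2) * pi * q * inverse (1 + (tan \<theta> * q)\<^sup>2)) / (pi * (1 - a\<^sup>2))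
        = 1 / ((1 + a)\<^sup>2 * (cos \<theta>)\<^sup>2 + (1 - a)\<^sup>2 * (sin \<theta>)\<^sup>2)"
    proof -
      have "1 + (tan \<theta> * q)\<^sup>2 = ((1 + a)\<^sup>2 * (cos \<theta>)\<^sup>2 + (1 - a)\<^sup>2 * (sin \<theta>)\<^sup>2) / ((1 + a)\<^sup>2 * (cos \<theta>)\<^sup>2)"
        using c a_pos by (simp add: q_def tan_def power_mult_distrib power_divide add_divide_distrib mult.commute)
      \<comment> \<open>The cancellation is done for opaque positive numbers, to be instantiated by
        \<open>cos \<theta>\<close>, \<open>1 + a\<close>, \<open>1 - a\<close> and the quadratic
        form in \<open>pos\<close>.\<close>
      moreover have "inverse (C\<^sup>2) * pi * (Q / P) * inverse (D / (P\<^sup>2 * C\<^sup>2)) / (pi * (Q * P)) = 1 / D"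
        if "C > 0" "P > 0" "Q > 0" "D > 0" for C P Q D :: real
        using that by (simp add: field_simps power2_eq_square)
      ultimately show ?thesis
        using c a_pos pos unfolding a2 q_def by metis
    qed
    also have "(1 + a)\<^sup>2 * (cos \<theta>)\<^sup>2 + (1 - a)\<^sup>2 * (sin \<theta>)\<^sup>2 = 1 + a\<^sup>2 - 2 * a * cos (2 * pi * f)"
      unfolding s cos2 by (simp add: power2_eq_square algebra_simps)
    finally show ?thesis by (simp only: integrand)
  qed
  have "(?g has_integral (G (1 - e) - G e)) {e..1 - e}"
    using e deriv
    by (intro fundamental_theorem_of_calculus) (auto simp flip: has_real_derivative_iff_has_vector_derivative)
  moreover have "G (1 - e) = F (pi * (1 - 2 * e)) / (pi * (1 - a\<^sup>2))"
    "G e = F (- pi * (1 - 2 * e)) / (pi * (1 - a\<^sup>2))"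
    by (simp_all add: G_def F_def q_def algebra_simps diff_divide_distrib)
  ultimately show ?thesis by (simp add: diff_divide_distrib)
qed

subsection \<open>Sequences with a given z-transform\<close>

lemma has_sum_finite_sum:
  fixes f :: "'i \<Rightarrow> 'k \<Rightarrow> 'a::topological_comm_monoid_add"
  assumes "finite I" "\<And>i. i \<in> I \<Longrightarrow> (f i has_sum S i) K"
  shows "((\<lambda>k. \<Sum>i\<in>I. f i k) has_sum (\<Sum>i\<in>I. S i)) K"
  using assms by (induction rule: finite_induct) (auto intro!: has_sum_add)

lemma has_sum_vecI:
  fixes f :: "'k \<Rightarrow> 'a::topological_comm_monoid_add ^ 'n"
  assumes "\<And>i. ((\<lambda>k. f k $ i) has_sum S $ i) K"
  shows "(f has_sum S) K"
  using assms unfolding has_sum_def by (intro vec_tendstoI) simp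

lemma has_sum_vecD:
  fixes f :: "'k \<Rightarrow> 'a::topological_comm_monoid_add ^ 'n"
  assumes "(f has_sum S) K"
  shows "((\<lambda>k. f k $ i) has_sum S $ i) K"
  using assms unfolding has_sum_def by (auto dest: tendsto_vec_nth[where i = i])

text \<open>Averaging \<open>z powi m\<close> times the series over the \<open>N\<close>-th roots of unity keeps the \<open>m\<close>-th
  coefficient and kills all others with index at distance less than \<open>N\<close> from \<open>m\<close>; the remaining ones
  form a tail of an absolutely convergent series.\<close>

lemma laurent_coefficients_zero:
  fixes c :: "int \<Rightarrow> complex"
  assumes zero: "\<And>z. cmod z = 1 \<Longrightarrow> ((\<lambda>k. c k * z powi (- k)) has_sum 0) UNIV"
  shows "c m = 0"
proof -
  \<comment> \<open>At \<open>z = 1\<close> all powers are 1, so the coefficients themselves are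
    summable, and unconditional summability of complex numbers is absolute.\<close>
  have "(\<lambda>k. c k) summable_on UNIV"
    using has_sum_imp_summable[OF zero[of 1]] by simp
  then have abs: "(\<lambda>k. cmod (c k)) summable_on UNIV"
    using summable_on_iff_abs_summable_on_complex by blast
  have "cmod (c m) \<le> e" if "e > 0" for e
  proof -
    obtain F where F: "finite F" "dist (sum (\<lambda>k. cmod (c k)) F) (\<Sum>\<^sub>\<infinity>k. cmod (c k)) \<le> e"
      using has_sum_finite_approximation[OF has_sum_infsum[OF abs] \<open>e > 0\<close>] by auto
    \<comment> \<open>The sum bounds each distance from \<open>m\<close> to an element of
      \<open>F\<close>; \<open>Suc\<close> makes the bound strict and keeps \<open>N\<close>
      positive when \<open>F\<close> is empty.\<close>
    define N where "N = Suc (\<Sum>k\<in>F. nat \<bar>m - k\<bar>)"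
    have N_pos: "N > 0" by (simp add: N_def)
    have N: "\<bar>m - k\<bar> < int N" if "k \<in> F" for k
    proof -
      have "nat \<bar>m - k\<bar> \<le> (\<Sum>k\<in>F. nat \<bar>m - k\<bar>)"
        using F that by (intro member_le_sum) auto
      then show ?thesis unfolding N_def by linarith
    qed
    define \<omega> where "\<omega> d = cis (2 * pi * real_of_int d / real N)" for d
    have \<omega>_norm: "cmod (\<omega> d) = 1" for d by (simp add: \<omega>_def)
    \<comment> \<open>Since \<open>\<omega> d ^ j\<close> is the \<open>d\<close>-th power of the
      root of unity \<open>\<omega> j\<close>, \<open>R d\<close> is the \<open>d\<close>-th power
      sum of the \<open>N\<close>-th roots of unity.\<close>
    define R where "R d = (\<Sum>j<N. \<omega> d ^ j)" for d
    have R0: "R 0 = of_nat N" by (simp add: R_def \<omega>_def)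
    have R_zero: "R d = 0" if "d \<noteq> 0" "\<bar>d\<bar> < int N" for d
    proof -
      have "\<omega> d \<noteq> 1"
      proof
        assume "\<omega> d = 1"
        then have "cos (2 * pi * real_of_int d / real N) = 1"
          by (simp add: \<omega>_def complex_eq_iff)
        then obtain x :: int where "2 * pi * real_of_int d / real N = x * 2 * pi"
          using cos_one_2pi_int by auto
        then have "real_of_int d = of_int x * real N"
          using N_pos by (simp add: field_simps)
        then have d: "d = x * int N"
          by (metis of_int_eq_iff of_int_mult of_int_of_nat_eq)
        then have "int N dvd d" by simp
        then show False using that zdvd_imp_le[of "int N" "\<bar>d\<bar>"] by auto
      qed
      moreover have "\<omega> d ^ N = 1"
      proof -
        have "real N * (2 * pi * real_of_int d / real N) = 2 * pi * real_of_int d"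
          using N_pos by simp
        then show ?thesis by (simp only: \<omega>_def Complex.DeMoivre cis_multiple_2pi Ints_of_int)
      qed
      ultimately show ?thesis by (simp add: R_def geometric_sum)
    qed
    have R_le: "cmod (R d) \<le> real N" for d
    proof -
      have "cmod (R d) \<le> (\<Sum>j<N. cmod (\<omega> d ^ j))" unfolding R_def by (rule norm_sum)
      then show ?thesis by (simp add: \<omega>_norm norm_power)
    qed
    \<comment> \<open>The vanishing series at the \<open>N\<close> roots are added with weights
      \<open>\<omega> j powi m\<close>; collecting the factors of \<open>c k\<close> gives
      \<open>R (m - k)\<close>.\<close>
    have "((\<lambda>k. c k * R (m - k)) has_sum 0) UNIV"
    proof -
      have "((\<lambda>k. \<Sum>j<N. \<omega> j powi m * (c k * \<omega> j powi (- k))) has_sum (\<Sum>j<N. \<omega> j powi m * 0)) UNIV"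
        by (intro has_sum_finite_sum has_sum_cmult_right zero) (auto simp: \<omega>_norm)
      moreover have "\<omega> (int j) powi m * (c k * \<omega> (int j) powi (- k)) = c k * \<omega> (m - k) ^ j" for j k
      proof -
        have "\<omega> (int j) powi m * \<omega> (int j) powi (- k) = \<omega> (m - k) ^ j"
          by (simp add: \<omega>_def cis_power_int Complex.DeMoivre cis_mult) (simp add: algebra_simps diff_divide_distrib)
        then show ?thesis by (simp add: mult_ac)
      qed
      ultimately show ?thesis by (simp add: R_def sum_distrib_left)
    qed
    then have "((\<lambda>k. c k * R (m - k)) has_sum (0 - c m * R 0)) (UNIV - {m})"
      by (intro has_sum_Diff) (auto intro!: has_sum_finiteI)
    then have sum1: "((\<lambda>k. c k * R (m - k)) has_sum (- (c m * of_nat N))) (UNIV - {m})"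
      by (simp add: R0)
    \<comment> \<open>Indices in \<open>F\<close> other than \<open>m\<close> carry the factor
      \<open>R (m - k) = 0\<close>, so discarding them leaves the sum unchanged.\<close>
    have "((\<lambda>k. c k * R (m - k)) has_sum (- (c m * of_nat N))) (- (insert m F))"
      using sum1 R_zero N by (subst has_sum_cong_neutral[where T = "UNIV - {m}"]) auto
    moreover have "((\<lambda>k. cmod (c k)) has_sum ((\<Sum>\<^sub>\<infinity>k. cmod (c k)) - sum (\<lambda>k. cmod (c k)) (insert m F))) (UNIV - insert m F)"
      using F by (intro has_sum_Diff has_sum_infsum abs) auto
    then have "((\<lambda>k. cmod (c k) * real N) has_sum (((\<Sum>\<^sub>\<infinity>k. cmod (c k)) - sum (\<lambda>k. cmod (c k)) (insert m F)) * real N)) (- insert m F)"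
      unfolding Compl_eq_Diff_UNIV by (rule has_sum_cmult_left)
    \<comment> \<open>By \<open>R_le\<close> the remaining series is at most \<open>N\<close> times
      the absolute tail outside \<open>insert m F\<close>, and the factor \<open>N\<close> then
      cancels.\<close>
    ultimately have "cmod (- (c m * of_nat N)) \<le> ((\<Sum>\<^sub>\<infinity>k. cmod (c k)) - sum (\<lambda>k. cmod (c k)) (insert m F)) * real N"
      by (rule norm_infsum_le) (auto simp: norm_mult R_le mult_left_mono)
    then have "cmod (c m) \<le> (\<Sum>\<^sub>\<infinity>k. cmod (c k)) - sum (\<lambda>k. cmod (c k)) (insert m F)"
      using N_pos by (simp add: norm_mult)
    also have "\<dots> \<le> (\<Sum>\<^sub>\<infinity>k. cmod (c k)) - sum (\<lambda>k. cmod (c k)) F"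
      using F by (intro diff_left_mono sum_mono2) auto
    also have "\<dots> \<le> e" using F by (simp add: dist_real_def)
    finally show ?thesis .
  qed
  then have "cmod (c m) \<le> 0" by (rule field_le_epsilon[of _ 0, simplified])
  then show ?thesis by simp
qed

text \<open>This is the causal response of the scalar recursion
  \<open>s (k + 1) = a * s k - \<gamma> * y k\<close> to a unit input at time 0. The input first
  acts on the state at time 1, hence the exponent \<open>k - 1\<close>.\<close>

definition exponential_response :: "real \<Rightarrow> real \<Rightarrow> int \<Rightarrow> real" where
  "exponential_response \<gamma> a k = (if k \<ge> 1 then - \<gamma> * a ^ nat (k - 1) else 0)"

lemma summable_geometric_bounded:
  fixes w :: "nat \<Rightarrow> 'a::{real_normed_field, banach}"
  assumes "\<bar>a\<bar> < 1" "\<And>m. norm (w m) \<le> B"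
  shows "summable (\<lambda>m. norm (of_real a ^ m * w m))"
proof (rule summable_comparison_test')
  show "summable (\<lambda>m. \<bar>a\<bar> ^ m * B)" using assms by (intro summable_mult2 summable_geometric) simp
  show "norm (norm (of_real a ^ m * w m)) \<le> \<bar>a\<bar> ^ m * B" for m
    using assms(2)[of m] by (simp add: norm_mult norm_power mult_left_mono)
qed

text \<open>The response lives on \<open>j >= 1\<close>, so \<open>j = m + 1\<close> turns the
  two-sided sum into an absolutely convergent power series in \<open>a\<close>. The weights
  \<open>w\<close> will be powers of \<open>z\<close> for the z-transform and noise values for the
  convolution.\<close>

lemma has_sum_exponential_response:
  fixes w :: "int \<Rightarrow> 'a::{real_normed_field, banach}"
  assumes a: "\<bar>a\<bar> < 1" and B: "\<And>j. norm (w j) \<le> B"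
  shows "((\<lambda>j. of_real (exponential_response \<gamma> a j) * w j)
    has_sum - of_real \<gamma> * (\<Sum>m. of_real a ^ m * w (int m + 1))) UNIV"
proof -
  have abs: "summable (\<lambda>m. norm (of_real a ^ m * w (int m + 1)))"
    by (rule summable_geometric_bounded[OF a B])
  have "((\<lambda>m. of_real a ^ m * w (int m + 1)) has_sum (\<Sum>m. of_real a ^ m * w (int m + 1))) UNIV"
    by (rule norm_summable_imp_has_sum[OF abs summable_sums[OF summable_norm_cancel[OF abs]]])
  then have "((\<lambda>m. - of_real \<gamma> * (of_real a ^ m * w (int m + 1)))
      has_sum (- of_real \<gamma> * (\<Sum>m. of_real a ^ m * w (int m + 1)))) UNIV"
    by (rule has_sum_cmult_right)
  also have "?this \<longleftrightarrow> ((\<lambda>j. of_real (exponential_response \<gamma> a j) * w j)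
    has_sum - of_real \<gamma> * (\<Sum>m. of_real a ^ m * w (int m + 1))) {1..}"
    by (rule has_sum_reindex_bij_witness[where i = "\<lambda>k. nat (k - 1)" and j = "\<lambda>m. int m + 1"])
      (auto simp: exponential_response_def)
  also have "\<dots> \<longleftrightarrow> ((\<lambda>j. of_real (exponential_response \<gamma> a j) * w j)
    has_sum - of_real \<gamma> * (\<Sum>m. of_real a ^ m * w (int m + 1))) UNIV"
    by (rule has_sum_cong_neutral) (auto simp: exponential_response_def)
  finally show ?thesis .
qed

text \<open>Expand \<open>1 / (z - a)\<close> as a geometric series in \<open>a / z\<close>, whose
  modulus is below 1 on the unit circle.\<close>

lemma exponential_response_z_transform:
  assumes a: "\<bar>a\<bar> < 1" and z: "cmod z = 1"
  shows "((\<lambda>k. of_real (exponential_response \<gamma> a k) * z powi (- k))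
    has_sum - of_real \<gamma> / (z - of_real a)) UNIV"
proof -
  have z0: "z \<noteq> 0" using z by auto
  have za: "z \<noteq> of_real a" using a z by auto
  have "(\<lambda>m. (of_real a / z) ^ m) sums (1 / (1 - of_real a / z))"
    using a z by (intro geometric_sums) (simp add: norm_divide)
  then have "(\<lambda>m. (of_real a / z) ^ m * (1 / z)) sums (1 / (1 - of_real a / z) * (1 / z))"
    by (rule sums_mult2)
  moreover have "(of_real a / z) ^ m * (1 / z) = of_real a ^ m * z powi (- (int m + 1))" for m
  proof -
    have "z powi (- (int m + 1)) = inverse (z ^ Suc m)"
      by (metis of_nat_Suc add.commute power_int_minus power_int_of_nat)
    then show ?thesis by (simp add: power_mult_distrib power_inverse divide_inverse)
  qed
  moreover have "1 / (1 - of_real a / z) * (1 / z) = 1 / (z - of_real a)"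
    using z0 za by (simp add: field_simps)
  ultimately have "(\<lambda>m. of_real a ^ m * z powi (- (int m + 1))) sums (1 / (z - of_real a))"
    by simp
  then have "(\<Sum>m. of_real a ^ m * z powi (- (int m + 1))) = 1 / (z - of_real a)"
    by (rule sums_unique[symmetric])
  then show ?thesis
    using has_sum_exponential_response[OF a, of "\<lambda>k. z powi (- k)" 1 \<gamma>] z
    by (simp add: norm_power_int)
qed

subsection \<open>Matrices diagonal in an orthonormal basis\<close>

text \<open>\<open>matrix_inv\<close> is obtained by choice, so it can be computed only through
  uniqueness of two-sided inverses.\<close>

lemma matrix_inv_eqI:
  fixes B :: "'a::semiring_1^'n^'n"
  assumes "B ** C = mat 1" "C ** B = mat 1"
  shows "matrix_inv B = C"
proof -
  have "B ** matrix_inv B = mat 1 \<and> matrix_inv B ** B = mat 1"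
    unfolding matrix_inv_def by (rule someI[where x = C]) (use assms in simp)
  then have "matrix_inv B = (C ** B) ** matrix_inv B" "C = C ** (B ** matrix_inv B)"
    using assms by simp_all
  then show ?thesis by (metis matrix_mul_assoc)
qed

locale orthonormal_basis =
  fixes u :: "'d::finite \<Rightarrow> real^'d"
  assumes orthonormal: "u i \<bullet> u j = (if i = j then 1 else 0)"
begin

text \<open>The matrix with rows \<open>u i\<close> has its transpose as right inverse; for square
  matrices this is also a left inverse, which says the same about the columns.\<close>

lemma completeness: "(\<Sum>i\<in>UNIV. u i $ r * u i $ c) = (if r = c then 1 else 0)"
proof -
  define U where "U = (\<chi> i r. u i $ r)"
  have "U ** transpose U = mat 1"
    using orthonormal by (simp add: U_def vec_eq_iff matrix_matrix_mult_def transpose_def mat_def inner_vec_def)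
  then have "transpose U ** U = mat 1" using matrix_left_right_inverse by blast
  then have "(transpose U ** U) $ r $ c = mat 1 $ r $ c" by simp
  then show ?thesis by (simp add: U_def matrix_matrix_mult_def transpose_def mat_def)
qed

lemma expansion: "(\<Sum>i\<in>UNIV. (u i \<bullet> v) *\<^sub>R u i) = v"
proof -
  have "(\<Sum>i\<in>UNIV. (u i \<bullet> v) *\<^sub>R u i) $ r = v $ r" for r
  proof -
    have "(\<Sum>i\<in>UNIV. (u i \<bullet> v) *\<^sub>R u i) $ r = (\<Sum>i\<in>UNIV. \<Sum>c\<in>UNIV. v $ c * (u i $ r * u i $ c))"
      by (simp add: inner_vec_def sum_distrib_left mult_ac)
    also have "\<dots> = (\<Sum>c\<in>UNIV. \<Sum>i\<in>UNIV. v $ c * (u i $ r * u i $ c))"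
      by (rule sum.swap)
    also have "\<dots> = v $ r"
      by (simp add: completeness if_distrib cong: if_cong flip: sum_distrib_left)
    finally show ?thesis .
  qed
  then show ?thesis by (simp add: vec_eq_iff)
qed

lemma inner_combination: "u i \<bullet> (\<Sum>j\<in>UNIV. s j *\<^sub>R u j) = s i"
  by (simp add: inner_sum_right orthonormal if_distrib cong: if_cong)

text \<open>The functional calculus of the basis, with eigenvalue \<open>f i\<close> on
  \<open>u i\<close>. The scalars are generic so that the real matrix and the complex transfer
  function share one calculus.\<close>

definition spectral :: "('d \<Rightarrow> 'a::real_normed_field) \<Rightarrow> 'a^'d^'d" where
  "spectral f = (\<chi> r c. \<Sum>i\<in>UNIV. f i * of_real (u i $ r * u i $ c))"

text \<open>The rank-one matrices built from the \<open>u i\<close> are mutually orthogonal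
  projections: moving the sum over \<open>k\<close> innermost produces
  \<open>u i \<bullet> u j\<close>, and only the diagonal survives.\<close>

lemma spectral_mult: "spectral f ** spectral g = spectral (\<lambda>i. f i * g i)"
proof -
  have "(\<Sum>k\<in>UNIV. (\<Sum>i\<in>UNIV. f i * of_real (u i $ r * u i $ k)) * (\<Sum>j\<in>UNIV. g j * of_real (u j $ k * u j $ c)))
      = (\<Sum>i\<in>UNIV. f i * g i * of_real (u i $ r * u i $ c))" for r c
  proof -
    have "(\<Sum>k\<in>UNIV. (\<Sum>i\<in>UNIV. f i * of_real (u i $ r * u i $ k)) * (\<Sum>j\<in>UNIV. g j * of_real (u j $ k * u j $ c)))
      = (\<Sum>k\<in>UNIV. \<Sum>i\<in>UNIV. \<Sum>j\<in>UNIV. f i * g j * of_real (u i $ r * u j $ c) * of_real (u i $ k * u j $ k))"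
      by (simp add: sum_product mult_ac)
    also have "\<dots> = (\<Sum>i\<in>UNIV. \<Sum>k\<in>UNIV. \<Sum>j\<in>UNIV. f i * g j * of_real (u i $ r * u j $ c) * of_real (u i $ k * u j $ k))"
      by (rule sum.swap)
    also have "\<dots> = (\<Sum>i\<in>UNIV. \<Sum>j\<in>UNIV. \<Sum>k\<in>UNIV. f i * g j * of_real (u i $ r * u j $ c) * of_real (u i $ k * u j $ k))"
      by (intro sum.cong refl sum.swap)
    also have "\<dots> = (\<Sum>i\<in>UNIV. \<Sum>j\<in>UNIV. f i * g j * of_real (u i $ r * u j $ c) * of_real (u i \<bullet> u j))"
      by (simp add: inner_vec_def sum_distrib_left)
    also have "\<dots> = (\<Sum>i\<in>UNIV. f i * g i * of_real (u i $ r * u i $ c))"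
      by (intro sum.cong refl) (simp add: orthonormal if_distrib cong: if_cong)
    finally show ?thesis .
  qed
  then show ?thesis by (simp add: spectral_def matrix_matrix_mult_def vec_eq_iff)
qed

lemma spectral_const: "spectral (\<lambda>_. z) = mat z"
  by (simp add: spectral_def mat_def vec_eq_iff completeness flip: sum_distrib_left of_real_sum del: of_real_mult)

lemma spectral_add: "spectral f + spectral g = spectral (\<lambda>i. f i + g i)"
  by (simp add: spectral_def vec_eq_iff sum.distrib distrib_right)

lemma spectral_diff: "spectral f - spectral g = spectral (\<lambda>i. f i - g i)"
  by (simp add: spectral_def vec_eq_iff sum_subtractf left_diff_distrib)

lemma scaleR_spectral: "t *\<^sub>R spectral f = spectral (\<lambda>i. t *\<^sub>R f i)"
  by (simp add: spectral_def vec_eq_iff scaleR_sum_right)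

lemma map_matrix_of_real_spectral: "map_matrix of_real (spectral f) = spectral (\<lambda>i. of_real (f i))"
  by (simp add: spectral_def vec_eq_iff map_matrix_def)

lemma matrix_inv_spectral:
  assumes "\<And>i. f i \<noteq> 0"
  shows "matrix_inv (spectral f) = spectral (\<lambda>i. 1 / f i)"
  using assms by (intro matrix_inv_eqI) (simp_all add: spectral_mult spectral_const)

lemma spectral_mult_vec: "spectral f *v v = (\<Sum>i\<in>UNIV. (f i * (u i \<bullet> v)) *\<^sub>R u i)"
proof -
  have "(spectral f *v v) $ r = (\<Sum>c\<in>UNIV. \<Sum>i\<in>UNIV. f i * u i $ r * (u i $ c * v $ c))" for r
    by (simp add: spectral_def matrix_vector_mult_def sum_distrib_left mult_ac)
  also have "(\<Sum>c\<in>UNIV. \<Sum>i\<in>UNIV. f i * u i $ r * (u i $ c * v $ c))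
      = (\<Sum>i\<in>UNIV. \<Sum>c\<in>UNIV. f i * u i $ r * (u i $ c * v $ c))" for r
    by (rule sum.swap)
  also have "(\<Sum>i\<in>UNIV. \<Sum>c\<in>UNIV. f i * u i $ r * (u i $ c * v $ c)) = (\<Sum>i\<in>UNIV. (f i * (u i \<bullet> v)) *\<^sub>R u i) $ r" for r
    by (simp add: inner_vec_def sum_distrib_left mult_ac)
  finally show ?thesis by (simp add: vec_eq_iff)
qed

lemma spectral_eqI:
  assumes "\<And>i. B *v u i = l i *\<^sub>R u i"
  shows "B = spectral l"
proof -
  have "B *v v = spectral l *v v" for v
  proof -
    have "B *v v = B *v (\<Sum>i\<in>UNIV. (u i \<bullet> v) *\<^sub>R u i)" by (simp add: expansion)
    also have "\<dots> = (\<Sum>i\<in>UNIV. (u i \<bullet> v) *\<^sub>R (B *v u i))"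
      by (simp add: linear_sum[OF matrix_vector_mul_linear] linear_cmul[OF matrix_vector_mul_linear])
    also have "\<dots> = spectral l *v v" by (simp add: assms spectral_mult_vec mult.commute)
    finally show ?thesis .
  qed
  then show ?thesis by (simp add: matrix_eq)
qed

section \<open>Transfer function and impulse response in the eigenbasis\<close>

lemma transfer_function_spectral:
  assumes "\<And>i. z \<noteq> of_real (1 - \<gamma> * l i)"
  shows "transfer_function \<gamma> (spectral l) z = spectral (\<lambda>i. - of_real \<gamma> / (z - of_real (1 - \<gamma> * l i)))"
proof -
  have "mat z - mat 1 + \<gamma> *\<^sub>R map_matrix complex_of_real (spectral l)
      = spectral (\<lambda>i. z - of_real (1 - \<gamma> * l i))"
    by (simp add: map_matrix_of_real_spectral scaleR_spectral spectral_add spectral_diff flip: spectral_const)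
      (simp add: scaleR_conv_of_real algebra_simps)
  then show ?thesis
    using assms by (simp add: transfer_function_def matrix_inv_spectral scaleR_spectral)
      (simp add: scaleR_conv_of_real)
qed

text \<open>The definite description needs existence and uniqueness. Existence follows entrywise
  from the scalar z-transforms, because stability keeps the poles \<open>1 - \<gamma> * l i\<close>
  off the unit circle. Uniqueness is the vanishing of Laurent coefficients.\<close>

lemma impulse_response_spectral:
  assumes "\<And>i. \<bar>1 - \<gamma> * l i\<bar> < 1"
  shows "impulse_response \<gamma> (spectral l) = (\<lambda>k. spectral (\<lambda>i. exponential_response \<gamma> (1 - \<gamma> * l i) k))"
    (is "_ = ?H")
proof -
  let ?P = "\<lambda>H :: int \<Rightarrow> real^'d^'d. \<forall>z. cmod z = 1 \<longrightarrow>
     ((\<lambda>k. map_matrix (\<lambda>h. complex_of_real h * z powi (- k)) (H k))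
        has_sum transfer_function \<gamma> (spectral l) z) UNIV"
  have H: "?P ?H"
  proof (intro allI impI)
    fix z assume z: "cmod z = 1"
    have "z \<noteq> of_real (1 - \<gamma> * l i)" for i
      using assms[of i] z by (metis less_irrefl norm_of_real)
    then have T: "transfer_function \<gamma> (spectral l) z = spectral (\<lambda>i. - of_real \<gamma> / (z - of_real (1 - \<gamma> * l i)))"
      by (rule transfer_function_spectral)
    show "((\<lambda>k. map_matrix (\<lambda>h. complex_of_real h * z powi (- k)) (?H k))
        has_sum transfer_function \<gamma> (spectral l) z) UNIV"
      unfolding T
    proof (intro has_sum_vecI)
      fix r c
      have "((\<lambda>k. \<Sum>i\<in>UNIV. of_real (exponential_response \<gamma> (1 - \<gamma> * l i) k) * z powi (- k) * of_real (u i $ r * u i $ c))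
          has_sum (\<Sum>i\<in>UNIV. - of_real \<gamma> / (z - of_real (1 - \<gamma> * l i)) * of_real (u i $ r * u i $ c))) UNIV"
        using assms z by (intro has_sum_finite_sum has_sum_cmult_left exponential_response_z_transform) auto
      then show "((\<lambda>k. map_matrix (\<lambda>h. complex_of_real h * z powi (- k)) (?H k) $ r $ c)
          has_sum spectral (\<lambda>i. - of_real \<gamma> / (z - of_real (1 - \<gamma> * l i))) $ r $ c) UNIV"
        by (simp add: spectral_def sum_distrib_left mult_ac)
    qed
  qed
  moreover have "H' = ?H" if H': "?P H'" for H'
  proof -
    \<comment> \<open>Each entry of the difference of two candidates has a z-transform that vanishes
      on the whole circle.\<close>
    have "of_real (H' m $ r $ c - ?H m $ r $ c) = (0 :: complex)" for m r c
    proof (rule laurent_coefficients_zero)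
      fix z assume z: "cmod z = 1"
      have *: "((\<lambda>k. complex_of_real (G k $ r $ c) * z powi (- k)) has_sum
          transfer_function \<gamma> (spectral l) z $ r $ c) UNIV" if "?P G" for G
      proof -
        have "((\<lambda>k. map_matrix (\<lambda>h. complex_of_real h * z powi (- k)) (G k))
            has_sum transfer_function \<gamma> (spectral l) z) UNIV"
          using that z by blast
        from has_sum_vecD[OF has_sum_vecD[OF this, of r], of c] show ?thesis by simp
      qed
      from has_sum_add[OF *[OF H'] has_sum_cmult_right[OF *[OF H], of "- 1"]]
      show "((\<lambda>k. complex_of_real (H' k $ r $ c - ?H k $ r $ c) * z powi (- k)) has_sum 0) UNIV"
        by (simp add: left_diff_distrib)
    qed
    then have "H' m $ r $ c - ?H m $ r $ c = 0" for m r c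
      by (simp only: of_real_eq_0_iff)
    then show ?thesis unfolding fun_eq_iff vec_eq_iff by simp
  qed
  ultimately show ?thesis
    unfolding impulse_response_def by (intro the_equality)
qed

text \<open>Each eigencoordinate is a scalar convolution, reversed by
  \<open>j \<mapsto> k - j\<close>. Lag \<open>m = 0\<close> belongs to the input at time
  \<open>k - 1\<close>. As a \<open>has_sum\<close> statement it also shows that the
  \<open>infsum\<close> in the stationary iterate is a true sum and not the default 0.\<close>

lemma impulse_response_convolution:
  assumes a: "\<And>i. \<bar>1 - \<gamma> * l i\<bar> < 1" and B: "\<And>i j. \<bar>u i \<bullet> y j\<bar> \<le> B"
  shows "((\<lambda>j. impulse_response \<gamma> (spectral l) (k - j) *v y j)
    has_sum (\<Sum>i\<in>UNIV. (- \<gamma> * (\<Sum>m. (1 - \<gamma> * l i) ^ m * (u i \<bullet> y (k - 1 - int m)))) *\<^sub>R u i)) UNIV"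
proof -
  have "((\<lambda>j. exponential_response \<gamma> (1 - \<gamma> * l i) (k - j) * (u i \<bullet> y j))
      has_sum - \<gamma> * (\<Sum>m. (1 - \<gamma> * l i) ^ m * (u i \<bullet> y (k - 1 - int m)))) UNIV" for i
  proof -
    have "((\<lambda>j. exponential_response \<gamma> (1 - \<gamma> * l i) j * (u i \<bullet> y (k - j)))
      has_sum - \<gamma> * (\<Sum>m. (1 - \<gamma> * l i) ^ m * (u i \<bullet> y (k - 1 - int m)))) UNIV"
      using has_sum_exponential_response[OF a[of i], of "\<lambda>j. u i \<bullet> y (k - j)" B \<gamma>] B
      by (simp add: algebra_simps)
    also have "?this \<longleftrightarrow> ?thesis"
      by (rule has_sum_reindex_bij_witness[where i = "\<lambda>j. k - j" and j = "\<lambda>j. k - j"]) auto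
    finally show ?thesis .
  qed
  then have "((\<lambda>j. \<Sum>i\<in>UNIV. (exponential_response \<gamma> (1 - \<gamma> * l i) (k - j) * (u i \<bullet> y j)) *\<^sub>R u i)
    has_sum (\<Sum>i\<in>UNIV. (- \<gamma> * (\<Sum>m. (1 - \<gamma> * l i) ^ m * (u i \<bullet> y (k - 1 - int m)))) *\<^sub>R u i)) UNIV"
    by (intro has_sum_finite_sum has_sum_bounded_linear[OF bounded_linear_scaleR_left]) auto
  then show ?thesis
    by (simp add: impulse_response_spectral[OF a] spectral_mult_vec)
qed

end

subsection \<open>Second moments of the stationary iterates\<close>

text \<open>The partial sums converge pointwise and are uniformly bounded by a geometric series, so
  dominated convergence carries their first two moments to the limit. Orthogonality removes the
  cross terms, and the diagonal is a geometric series in the square of \<open>a\<close>.\<close>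

lemma (in prob_space) discounted_sum_of_orthogonal:
  fixes W :: "nat \<Rightarrow> 'a \<Rightarrow> real"
  assumes a: "\<bar>a\<bar> < 1"
    and meas [measurable]: "\<And>m. W m \<in> borel_measurable M"
    and bound: "\<And>m \<omega>. \<omega> \<in> space M \<Longrightarrow> \<bar>W m \<omega>\<bar> \<le> B"
    and mean: "\<And>m. expectation (W m) = 0"
    and var: "\<And>m. expectation (\<lambda>\<omega>. (W m \<omega>)\<^sup>2) = v"
    and orthogonal: "\<And>m m'. m \<noteq> m' \<Longrightarrow> expectation (\<lambda>\<omega>. W m \<omega> * W m' \<omega>) = 0"
  defines "S \<equiv> \<lambda>\<omega>. \<Sum>m. a ^ m * W m \<omega>"
  shows "S \<in> borel_measurable M"
    and "\<And>\<omega>. \<omega> \<in> space M \<Longrightarrow> \<bar>S \<omega>\<bar> \<le> B / (1 - \<bar>a\<bar>)"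
    and "expectation S = 0"
    and "expectation (\<lambda>\<omega>. (S \<omega>)\<^sup>2) = v / (1 - a\<^sup>2)"
proof -
  define T where "T N \<omega> = (\<Sum>m<N. a ^ m * W m \<omega>)" for N \<omega>
  have T_meas [measurable]: "T N \<in> borel_measurable M" for N unfolding T_def by measurable
  show S_meas [measurable]: "S \<in> borel_measurable M" unfolding S_def by measurable
  have T_lim: "(\<lambda>N. T N \<omega>) \<longlonglongrightarrow> S \<omega>" if "\<omega> \<in> space M" for \<omega>
    using summable_sums[OF summable_norm_cancel[OF summable_geometric_bounded[OF a, of "\<lambda>m. W m \<omega>" B]]] bound[OF that]
    by (simp add: S_def T_def sums_def)
  have T_bound: "\<bar>T N \<omega>\<bar> \<le> B / (1 - \<bar>a\<bar>)" if "\<omega> \<in> space M" for N \<omega>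
  proof -
    have "B \<ge> 0" using bound[OF that, of 0] by linarith
    have "\<bar>T N \<omega>\<bar> \<le> (\<Sum>m<N. \<bar>a ^ m * W m \<omega>\<bar>)" unfolding T_def by (rule sum_abs)
    also have "\<dots> \<le> (\<Sum>m<N. \<bar>a\<bar> ^ m * B)"
      using bound[OF that] by (intro sum_mono) (simp add: abs_mult power_abs mult_left_mono)
    also have "\<dots> \<le> (\<Sum>m. \<bar>a\<bar> ^ m * B)"
      using a \<open>B \<ge> 0\<close> by (intro sum_le_suminf summable_mult2 summable_geometric) auto
    also have "\<dots> = B / (1 - \<bar>a\<bar>)"
      using a by (simp add: suminf_geometric flip: suminf_mult2)
    finally show ?thesis .
  qed
  show S_bound: "\<bar>S \<omega>\<bar> \<le> B / (1 - \<bar>a\<bar>)" if "\<omega> \<in> space M" for \<omega>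
    using tendsto_rabs[OF T_lim[OF that]] T_bound[OF that] by (intro LIMSEQ_le_const2) auto
  have int_W: "integrable M (W m)" for m
    by (rule integrable_const_bound[of _ B]) (auto simp: bound)
  have int_WW: "integrable M (\<lambda>\<omega>. W m \<omega> * W m' \<omega>)" for m m'
  proof (rule integrable_const_bound[of _ "B * B"])
    show "AE \<omega> in M. norm (W m \<omega> * W m' \<omega>) \<le> B * B"
      using bound by (auto simp: abs_mult intro!: mult_mono' AE_I2)
  qed measurable
  have T_mean: "expectation (T N) = 0" for N
    unfolding T_def using int_W mean by simp
  have T_var: "expectation (\<lambda>\<omega>. (T N \<omega>)\<^sup>2) = (\<Sum>m<N. (a\<^sup>2) ^ m * v)" for N
  proof -
    have "(T N \<omega>)\<^sup>2 = (\<Sum>m<N. \<Sum>m'<N. a ^ m * a ^ m' * (W m \<omega> * W m' \<omega>))" for \<omega>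
      by (simp add: T_def power2_eq_square sum_product mult_ac)
    then have "expectation (\<lambda>\<omega>. (T N \<omega>)\<^sup>2)
        = (\<Sum>m<N. \<Sum>m'<N. a ^ m * a ^ m' * expectation (\<lambda>\<omega>. W m \<omega> * W m' \<omega>))"
      using int_WW by simp
    also have "\<dots> = (\<Sum>m<N. \<Sum>m'<N. if m = m' then (a\<^sup>2) ^ m * v else 0)"
      using orthogonal var
      by (intro sum.cong refl) (auto simp: power2_eq_square power_mult_distrib)
    finally show ?thesis by simp
  qed
  have "(\<lambda>N. expectation (T N)) \<longlonglongrightarrow> expectation S"
    using T_lim T_bound
    by (intro integral_dominated_convergence[where w = "\<lambda>_. B / (1 - \<bar>a\<bar>)"]) auto
  then show "expectation S = 0"
    by (simp add: T_mean LIMSEQ_const_iff)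
  have "(\<lambda>N. expectation (\<lambda>\<omega>. (T N \<omega>)\<^sup>2)) \<longlonglongrightarrow> expectation (\<lambda>\<omega>. (S \<omega>)\<^sup>2)"
  proof (intro integral_dominated_convergence[where w = "\<lambda>_. (B / (1 - \<bar>a\<bar>))\<^sup>2"])
    show "AE \<omega> in M. norm ((T N \<omega>)\<^sup>2) \<le> (B / (1 - \<bar>a\<bar>))\<^sup>2" for N
    proof (rule AE_I2)
      fix \<omega> assume "\<omega> \<in> space M"
      then have "\<bar>T N \<omega>\<bar>\<^sup>2 \<le> (B / (1 - \<bar>a\<bar>))\<^sup>2" by (intro power_mono T_bound) auto
      then show "norm ((T N \<omega>)\<^sup>2) \<le> (B / (1 - \<bar>a\<bar>))\<^sup>2" by simp
    qed
  qed (auto intro!: tendsto_power T_lim)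
  moreover have "(\<lambda>N. \<Sum>m<N. (a\<^sup>2) ^ m * v) \<longlonglongrightarrow> v / (1 - a\<^sup>2)"
  proof -
    have "norm (a\<^sup>2) < 1" using a by (simp add: abs_square_less_1)
    from sums_mult2[OF geometric_sums[OF this], of v] show ?thesis by (simp add: sums_def)
  qed
  ultimately show "expectation (\<lambda>\<omega>. (S \<omega>)\<^sup>2) = v / (1 - a\<^sup>2)"
    by (simp add: T_var LIMSEQ_unique)
qed

section \<open>Averages over the sample, and moments of the sampled noise\<close>

lemma linear_avg:
  assumes "linear f"
  shows "f (avg n v) = avg n (\<lambda>i. f (v i))"
  by (simp add: avg_def linear_sum[OF assms] linear_cmul[OF assms])

lemma linear_matrix_vector_mult_left: "linear (\<lambda>B :: real^'n^'m. B *v v)"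
  by (rule linearI) (simp_all add: matrix_vector_mult_add_rdistrib scaleR_matrix_vector_assoc)

lemma outer_mult_vec: "outer v w *v x = (w \<bullet> x) *\<^sub>R v"
  by (simp add: outer_def matrix_vector_mult_def vec_eq_iff inner_vec_def sum_distrib_left mult_ac)

text \<open>The right side is the second moment of the noise component along \<open>v\<close> under
  uniform sampling, which is how the covariance enters the variance.\<close>

lemma noise_cov_quadratic_form:
  "v \<bullet> (noise_cov n A b *v v) = avg n (\<lambda>i. (v \<bullet> noise n A b i)\<^sup>2)"
proof -
  have "linear (\<lambda>B. v \<bullet> (B *v v))"
    by (rule linear_compose[OF linear_matrix_vector_mult_left bounded_linear.linear[OF bounded_linear_inner_right], unfolded o_def])
  from linear_avg[OF this] show ?thesis
    by (simp add: noise_cov_def outer_mult_vec inner_commute power2_eq_square)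
qed

text \<open>Averaging turns the matrices \<open>A i\<close> into \<open>avg n A\<close>, which
  cancels against its inverse and leaves \<open>- avg n b + avg n b\<close>.\<close>

lemma avg_noise:
  assumes "avg n A ** matrix_inv (avg n A) = mat 1"
  shows "avg n (noise n A b) = 0"
proof -
  define p where "p = matrix_inv (avg n A) *v avg n b"
  have "avg n (noise n A b) = - avg n (\<lambda>i. A i *v p) + avg n b"
    by (simp add: noise_def p_def avg_def sum_subtractf algebra_simps)
  also have "\<dots> = - (avg n A *v (matrix_inv (avg n A) *v avg n b)) + avg n b"
    unfolding p_def by (simp only: linear_avg[OF linear_matrix_vector_mult_left])
  finally have "avg n (noise n A b) = - (avg n A *v (matrix_inv (avg n A) *v avg n b)) + avg n b" .
  then show ?thesis
    by (simp add: matrix_vector_mul_assoc assms)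
qed

lemma trace_outer: "trace (outer v v) = v \<bullet> v"
  by (simp add: trace_def outer_def inner_vec_def)

lemma bounded_linear_trace: "bounded_linear (trace :: real^'n^'n \<Rightarrow> real)"
  unfolding linear_conv_bounded_linear[symmetric]
  by (rule linearI) (simp_all add: trace_def sum.distrib sum_distrib_left)

lemma (in prob_space) expectation_uniform:
  fixes g :: "nat \<Rightarrow> real"
  assumes "I \<in> measurable M (count_space {1..n})"
    and "distr M (count_space {1..n}) I = uniform_count_measure {1..n}"
  shows "expectation (\<lambda>\<omega>. g (I \<omega>)) = avg n g"
proof -
  have "expectation (\<lambda>\<omega>. g (I \<omega>)) = integral\<^sup>L (uniform_count_measure {1..n}) g"
    using assms by (subst assms(2)[symmetric], subst integral_distr) auto
  then show ?thesis by (simp add: integral_uniform_count_measure avg_def)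
qed

lemma (in prob_space) expectation_product_indep:
  fixes g :: "nat \<Rightarrow> real"
  assumes indep: "indep_vars (\<lambda>_. count_space {1..n}) J UNIV" and "j \<noteq> j'"
  shows "expectation (\<lambda>\<omega>. g (J j \<omega>) * g (J j' \<omega>)) = expectation (\<lambda>\<omega>. g (J j \<omega>)) * expectation (\<lambda>\<omega>. g (J j' \<omega>))"
proof -
  have rv: "J k \<in> measurable M (count_space {1..n})" for k
    using indep by (auto simp: indep_vars_def)
  have int: "integrable M (\<lambda>\<omega>. g (J k \<omega>))" for k
  proof (rule integrable_const_bound[of _ "\<Sum>i\<in>{1..n}. \<bar>g i\<bar>"])
    show "AE \<omega> in M. norm (g (J k \<omega>)) \<le> (\<Sum>i\<in>{1..n}. \<bar>g i\<bar>)"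
      using measurable_space[OF rv[of k]]
      by (intro AE_I2) (auto intro!: member_le_sum[of _ _ "\<lambda>i. \<bar>g i\<bar>"])
    show "(\<lambda>\<omega>. g (J k \<omega>)) \<in> borel_measurable M"
      by (rule measurable_compose[OF rv]) simp
  qed
  have "indep_vars (\<lambda>_. borel) (\<lambda>k \<omega>. g (J k \<omega>)) {j, j'}"
    by (rule indep_vars_compose2[OF indep_vars_subset[OF indep], where Y = "\<lambda>_. g"]) auto
  from indep_vars_lebesgue_integral[OF _ this] int \<open>j \<noteq> j'\<close> show ?thesis by simp
qed

section \<open>Recursion and variance of the stationary iterates\<close>

context orthonormal_basis
begin

lemma inner_combination_self: "(\<Sum>i\<in>UNIV. s i *\<^sub>R u i) \<bullet> (\<Sum>i\<in>UNIV. s i *\<^sub>R u i) = (\<Sum>i\<in>UNIV. (s i)\<^sup>2)"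
proof -
  have "(\<Sum>i\<in>UNIV. s i *\<^sub>R u i) \<bullet> (\<Sum>i\<in>UNIV. s i *\<^sub>R u i)
      = (\<Sum>i\<in>UNIV. s i * (u i \<bullet> (\<Sum>i\<in>UNIV. s i *\<^sub>R u i)))"
    by (subst inner_sum_left) simp
  then show ?thesis by (simp add: inner_combination power2_eq_square)
qed

text \<open>The trace of an outer square is the squared norm, which by Parseval is the sum of
  squared coordinates. Hence correlations between different coordinates do not enter.\<close>

lemma trace_Var:
  fixes M :: "'w measure"
  assumes "prob_space M"
    and X: "\<And>\<omega>. \<omega> \<in> space M \<Longrightarrow> X \<omega> = p + (\<Sum>i\<in>UNIV. s i \<omega> *\<^sub>R u i)"
    and meas [measurable]: "\<And>i. s i \<in> borel_measurable M"
    and bound: "\<And>i \<omega>. \<omega> \<in> space M \<Longrightarrow> \<bar>s i \<omega>\<bar> \<le> B i"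
    and mean: "\<And>i. (\<integral>\<omega>. s i \<omega> \<partial>M) = 0"
  shows "X \<in> borel_measurable M" "integrable M (\<lambda>\<omega>. (norm (X \<omega>))\<^sup>2)"
    "trace (Var M X) = (\<Sum>i\<in>UNIV. \<integral>\<omega>. (s i \<omega>)\<^sup>2 \<partial>M)"
proof -
  interpret prob_space M by fact
  let ?V = "\<lambda>\<omega>. \<Sum>i\<in>UNIV. s i \<omega> *\<^sub>R u i"
  have "(\<lambda>\<omega>. p + ?V \<omega>) \<in> borel_measurable M" by measurable
  then show X_meas [measurable]: "X \<in> borel_measurable M"
    using X by (simp cong: measurable_cong)
  have int_s: "integrable M (s i)" for i
    by (rule integrable_const_bound[of _ "B i"]) (auto simp: bound)
  have int_ss: "integrable M (\<lambda>\<omega>. s i \<omega> * s j \<omega>)" for i j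
  proof (rule integrable_const_bound[of _ "B i * B j"])
    show "AE \<omega> in M. norm (s i \<omega> * s j \<omega>) \<le> B i * B j"
      using bound by (auto simp: abs_mult intro!: mult_mono' AE_I2)
  qed measurable
  show "integrable M (\<lambda>\<omega>. (norm (X \<omega>))\<^sup>2)"
  proof (rule integrable_const_bound[of _ "(norm p + (\<Sum>i\<in>UNIV. B i))\<^sup>2"])
    show "AE \<omega> in M. norm ((norm (X \<omega>))\<^sup>2) \<le> (norm p + (\<Sum>i\<in>UNIV. B i))\<^sup>2"
    proof (rule AE_I2)
      fix \<omega> assume \<omega>: "\<omega> \<in> space M"
      have "norm (u i) = 1" for i by (simp add: norm_eq_sqrt_inner orthonormal)
      then have "norm (?V \<omega>) \<le> (\<Sum>i\<in>UNIV. B i)"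
        using bound[OF \<omega>] by (intro order_trans[OF norm_sum] sum_mono) simp
      then have "norm (X \<omega>) \<le> norm p + (\<Sum>i\<in>UNIV. B i)"
        unfolding X[OF \<omega>] by (intro order_trans[OF norm_triangle_ineq]) simp
      then show "norm ((norm (X \<omega>))\<^sup>2) \<le> (norm p + (\<Sum>i\<in>UNIV. B i))\<^sup>2"
        by (simp add: power_mono)
    qed
  qed measurable
  have "(\<integral>\<omega>. X \<omega> \<partial>M) = (\<integral>\<omega>. p + ?V \<omega> \<partial>M)"
    by (intro Bochner_Integration.integral_cong refl X)
  also have "\<dots> = p"
    using int_s mean by (simp add: prob_space)
  finally have EX: "(\<integral>\<omega>. X \<omega> \<partial>M) = p" .
  have outer_V: "outer (?V \<omega>) (?V \<omega>) = (\<Sum>i\<in>UNIV. \<Sum>j\<in>UNIV. (s i \<omega> * s j \<omega>) *\<^sub>R outer (u i) (u j))" for \<omega>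
    by (simp add: outer_def vec_eq_iff sum_product mult_ac)
  \<comment> \<open>Integrability of the matrix-valued function is what allows the trace to be taken
    under the integral.\<close>
  have int_outer: "integrable M (\<lambda>\<omega>. outer (?V \<omega>) (?V \<omega>))"
    unfolding outer_V using int_ss by (intro Bochner_Integration.integrable_sum integrable_scaleR_left) auto
  have "Var M X = (\<integral>\<omega>. outer (?V \<omega>) (?V \<omega>) \<partial>M)"
    unfolding Var_def EX by (intro Bochner_Integration.integral_cong refl) (simp add: X)
  then have "trace (Var M X) = (\<integral>\<omega>. trace (outer (?V \<omega>) (?V \<omega>)) \<partial>M)"
    using integral_bounded_linear[OF bounded_linear_trace int_outer] by simp
  also have "\<dots> = (\<Sum>i\<in>UNIV. \<integral>\<omega>. (s i \<omega>)\<^sup>2 \<partial>M)"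
    using int_ss by (simp add: trace_outer inner_combination_self power2_eq_square)
  finally show "trace (Var M X) = (\<Sum>i\<in>UNIV. \<integral>\<omega>. (s i \<omega>)\<^sup>2 \<partial>M)" .
qed

lemma stationary_iterate_spectral:
  fixes \<omega> :: 'w
  assumes A: "avg n A = spectral l" and a: "\<And>i. \<bar>1 - \<gamma> * l i\<bar> < 1"
    and J: "\<And>j. J j \<omega> \<in> {1..n}"
  shows "stationary_iterate \<gamma> n A b J k \<omega> = optimum n A b
    + (\<Sum>i\<in>UNIV. (- \<gamma> * (\<Sum>m. (1 - \<gamma> * l i) ^ m * (u i \<bullet> noise n A b (J (k - 1 - int m) \<omega>)))) *\<^sub>R u i)"
proof -
  \<comment> \<open>Only finitely many noise vectors occur, so the sum of their norms bounds every
    input at every time, as the convolution requires.\<close>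
  have "\<bar>u i \<bullet> noise n A b (J j \<omega>)\<bar> \<le> (\<Sum>m\<in>{1..n}. norm (noise n A b m))" for i j
  proof -
    have "\<bar>u i \<bullet> noise n A b (J j \<omega>)\<bar> \<le> norm (noise n A b (J j \<omega>))"
      using Cauchy_Schwarz_ineq2[of "u i" "noise n A b (J j \<omega>)"] by (simp add: norm_eq_sqrt_inner orthonormal)
    also have "\<dots> \<le> (\<Sum>m\<in>{1..n}. norm (noise n A b m))"
      using J by (intro member_le_sum) auto
    finally show ?thesis .
  qed
  from infsumI[OF impulse_response_convolution[OF a this]] show ?thesis
    by (simp add: stationary_iterate_def A)
qed

text \<open>In coordinates, splitting off the most recent noise from the discounted sum gives
  \<open>s i (k + 1) = (1 - \<gamma> * l i) * s i k - \<gamma> * w i k\<close>, which is the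
  gradient step read along \<open>u i\<close>.\<close>

lemma stationary_iterate_recursion:
  fixes \<omega> :: 'w and b :: "nat \<Rightarrow> real^'d"
  assumes A: "avg n A = spectral l" and a: "\<And>i. \<bar>1 - \<gamma> * l i\<bar> < 1"
    and inv: "avg n A ** matrix_inv (avg n A) = mat 1"
    and J: "\<And>j. J j \<omega> \<in> {1..n}"
  defines "x \<equiv> stationary_iterate \<gamma> n A b J"
  shows "x (k + 1) \<omega> = x k \<omega> - \<gamma> *\<^sub>R zeroth_order_grad n A b (J k \<omega>) (x k \<omega>)"
proof -
  define w where "w i j = u i \<bullet> noise n A b (J j \<omega>)" for i j
  define s where "s i k = - \<gamma> * (\<Sum>m. (1 - \<gamma> * l i) ^ m * w i (k - 1 - int m))" for i k
  have x: "x k \<omega> = optimum n A b + (\<Sum>i\<in>UNIV. s i k *\<^sub>R u i)" for k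
    unfolding x_def s_def w_def by (rule stationary_iterate_spectral[where l = l]) (fact A a J)+
  have s: "s i (k + 1) = (1 - \<gamma> * l i) * s i k - \<gamma> * w i k" for i
  proof -
    have bound: "norm (w i j) \<le> (\<Sum>m\<in>{1..n}. \<bar>u i \<bullet> noise n A b m\<bar>)" for j
      unfolding w_def real_norm_def using J by (intro member_le_sum[of _ _ "\<lambda>m. \<bar>u i \<bullet> noise n A b m\<bar>"]) auto
    have summable: "summable (\<lambda>m. (1 - \<gamma> * l i) ^ m * w i (k - int m))" for k
      using summable_norm_cancel[OF summable_geometric_bounded[OF a[of i], of "\<lambda>m. w i (k - int m)", OF bound]] by simp
    have "(\<Sum>m. (1 - \<gamma> * l i) ^ m * w i (k - int m))
        = w i k + (\<Sum>m. (1 - \<gamma> * l i) ^ Suc m * w i (k - int (Suc m)))"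
      using suminf_split_head[OF summable[of k]] by simp
    also have "(\<Sum>m. (1 - \<gamma> * l i) ^ Suc m * w i (k - int (Suc m)))
        = (1 - \<gamma> * l i) * (\<Sum>m. (1 - \<gamma> * l i) ^ m * w i (k - 1 - int m))"
      using suminf_mult[OF summable[of "k - 1"], of "1 - \<gamma> * l i"] by (simp add: mult_ac diff_diff_eq)
    finally have split: "(\<Sum>m. (1 - \<gamma> * l i) ^ m * w i (k - int m))
        = w i k + (1 - \<gamma> * l i) * (\<Sum>m. (1 - \<gamma> * l i) ^ m * w i (k - 1 - int m))" .
    have "s i (k + 1) = - \<gamma> * (\<Sum>m. (1 - \<gamma> * l i) ^ m * w i (k - int m))"
      by (simp add: s_def)
    then show ?thesis unfolding split s_def by (simp add: algebra_simps)
  qed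
  \<comment> \<open>The optimum annihilates the mean gradient, so only the error and the sampled
    noise remain.\<close>
  have opt: "avg n A *v optimum n A b + avg n b = 0"
    by (simp add: optimum_def linear_neg[OF matrix_vector_mul_linear] matrix_vector_mul_assoc inv)
  have "zeroth_order_grad n A b (J k \<omega>) (x k \<omega>)
      = avg n A *v (\<Sum>i\<in>UNIV. s i k *\<^sub>R u i) + noise n A b (J k \<omega>)"
    using opt by (simp add: zeroth_order_grad_def x matrix_vector_right_distrib algebra_simps)
  also have "\<dots> = (\<Sum>i\<in>UNIV. (l i * s i k + w i k) *\<^sub>R u i)"
    unfolding A spectral_mult_vec inner_combination w_def scaleR_left_distrib sum.distrib expansion ..
  finally have "zeroth_order_grad n A b (J k \<omega>) (x k \<omega>) = (\<Sum>i\<in>UNIV. (l i * s i k + w i k) *\<^sub>R u i)" .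
  moreover have "(\<Sum>i\<in>UNIV. s i (k + 1) *\<^sub>R u i)
      = (\<Sum>i\<in>UNIV. s i k *\<^sub>R u i) - \<gamma> *\<^sub>R (\<Sum>i\<in>UNIV. (l i * s i k + w i k) *\<^sub>R u i)"
    unfolding s scaleR_sum_right sum_subtractf[symmetric]
    by (intro sum.cong refl) (simp add: algebra_simps)
  ultimately show ?thesis by (simp add: x)
qed

text \<open>The coordinates of the error are \<open>- \<gamma> * S i\<close>, discounted sums of
  past noise. Uniform sampling supplies mean and second moment; independence across times supplies
  orthogonality.\<close>

lemma trace_Var_stationary_iterate:
  fixes M :: "'w measure" and b :: "nat \<Rightarrow> real^'d"
  assumes A: "avg n A = spectral l" and a: "\<And>i. \<bar>1 - \<gamma> * l i\<bar> < 1"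
    and inv: "avg n A ** matrix_inv (avg n A) = mat 1"
    and M: "prob_space M"
    and J_indep: "prob_space.indep_vars M (\<lambda>_. count_space {1..n}) J UNIV"
    and J_uniform: "\<And>k. distr M (count_space {1..n}) (J k) = uniform_count_measure {1..n}"
  defines "x \<equiv> stationary_iterate \<gamma> n A b J"
  shows "x k \<in> borel_measurable M" "integrable M (\<lambda>\<omega>. (norm (x k \<omega>))\<^sup>2)"
    "trace (Var M (x k)) = (\<Sum>i\<in>UNIV. \<gamma>\<^sup>2 * ((u i \<bullet> (noise_cov n A b *v u i)) / (1 - (1 - \<gamma> * l i)\<^sup>2)))"
proof -
  interpret prob_space M by fact
  define w where "w i m \<omega> = u i \<bullet> noise n A b (J (k - 1 - int m) \<omega>)" for i m \<omega>
  define S where "S i \<omega> = (\<Sum>m. (1 - \<gamma> * l i) ^ m * w i m \<omega>)" for i \<omega>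
  define B where "B i = (\<Sum>m\<in>{1..n}. \<bar>u i \<bullet> noise n A b m\<bar>)" for i
  have rv: "J j \<in> measurable M (count_space {1..n})" for j
    using J_indep by (auto simp: indep_vars_def)
  have J: "J j \<omega> \<in> {1..n}" if "\<omega> \<in> space M" for j \<omega>
    using measurable_space[OF rv that] by simp
  have w_meas: "w i m \<in> borel_measurable M" for i m
    unfolding w_def by (rule measurable_compose[OF rv]) simp
  have w_bound: "\<bar>w i m \<omega>\<bar> \<le> B i" if "\<omega> \<in> space M" for i m \<omega>
    unfolding w_def B_def using J[OF that] by (intro member_le_sum[of _ _ "\<lambda>m. \<bar>u i \<bullet> noise n A b m\<bar>"]) auto
  have w_mean: "expectation (w i m) = 0" for i m
  proof -
    have "expectation (w i m) = avg n (\<lambda>j. u i \<bullet> noise n A b j)"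
      unfolding w_def by (rule expectation_uniform[OF rv J_uniform])
    also have "\<dots> = u i \<bullet> avg n (noise n A b)"
      by (rule linear_avg[symmetric]) (rule bounded_linear.linear[OF bounded_linear_inner_right])
    finally show ?thesis by (simp add: avg_noise[OF inv])
  qed
  have w_var: "expectation (\<lambda>\<omega>. (w i m \<omega>)\<^sup>2) = u i \<bullet> (noise_cov n A b *v u i)" for i m
    unfolding w_def noise_cov_quadratic_form
    by (rule expectation_uniform[OF rv J_uniform, of "\<lambda>j. (u i \<bullet> noise n A b j)\<^sup>2"])
  \<comment> \<open>Distinct lags refer to distinct sampling times, so the expectation factors into
    two vanishing means.\<close>
  have w_orthogonal: "expectation (\<lambda>\<omega>. w i m \<omega> * w i m' \<omega>) = 0" if "m \<noteq> m'" for i m m'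
  proof -
    have "expectation (\<lambda>\<omega>. w i m \<omega> * w i m' \<omega>) = expectation (w i m) * expectation (w i m')"
      unfolding w_def
      by (rule expectation_product_indep[OF J_indep, of _ _ "\<lambda>j. u i \<bullet> noise n A b j"]) (use that in auto)
    then show ?thesis by (simp add: w_mean)
  qed
  note S = discounted_sum_of_orthogonal[where W = "w i" and B = "B i" and a = "1 - \<gamma> * l i" for i,
      OF a w_meas w_bound w_mean w_var w_orthogonal, folded S_def]
  have x: "x k \<omega> = optimum n A b + (\<Sum>i\<in>UNIV. (- \<gamma> * S i \<omega>) *\<^sub>R u i)" if "\<omega> \<in> space M" for \<omega>
    unfolding x_def S_def w_def by (rule stationary_iterate_spectral[where J = J and \<omega> = \<omega>, OF A a J[OF that]])
  have meas: "(\<lambda>\<omega>. - \<gamma> * S i \<omega>) \<in> borel_measurable M" for i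
    by (rule borel_measurable_times[OF borel_measurable_const S(1)])
  have bound: "\<bar>- \<gamma> * S i \<omega>\<bar> \<le> \<bar>\<gamma>\<bar> * (B i / (1 - \<bar>1 - \<gamma> * l i\<bar>))" if "\<omega> \<in> space M" for i \<omega>
    unfolding abs_mult abs_minus_cancel by (intro mult_left_mono S(2) that abs_ge_zero)
  have mean: "expectation (\<lambda>\<omega>. - \<gamma> * S i \<omega>) = 0" for i
    using S(3)[of i] by simp
  note tv = trace_Var[where X = "x k" and s = "\<lambda>i \<omega>. - \<gamma> * S i \<omega>", OF M x meas bound mean]
  show "x k \<in> borel_measurable M" by (rule tv(1))
  show "integrable M (\<lambda>\<omega>. (norm (x k \<omega>))\<^sup>2)" by (rule tv(2))
  show "trace (Var M (x k)) = (\<Sum>i\<in>UNIV. \<gamma>\<^sup>2 * ((u i \<bullet> (noise_cov n A b *v u i)) / (1 - (1 - \<gamma> * l i)\<^sup>2)))"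
    using tv(3) S(4) by (simp add: power_mult_distrib)
qed

end

text \<open>For \<open>\<gamma> * l > 2\<close> and \<open>\<epsilon> < 1/2\<close> the integral is
  positive but the right side negative, hence the bound \<open>\<gamma> * l < 2\<close>. The
  recursion clause certifies that the iterates perform SGD, and the integrability clause that
  \<open>Var\<close> is not a default value.\<close>

theorem lemma5:
  fixes \<gamma> :: real
    and n :: nat
    and A :: "nat \<Rightarrow> real^'d^'d"
    and b :: "nat \<Rightarrow> real^'d"
    and u :: "'d \<Rightarrow> real^'d"
    and lam :: "'d \<Rightarrow> real"
    and M :: "'w measure"
    and J :: "int \<Rightarrow> 'w \<Rightarrow> nat"
  assumes gamma_pos: "\<gamma> > 0"
    and n_pos: "n \<ge> 1"
    and A_sym: "\<And>i. i \<in> {1..n} \<Longrightarrow> transpose (A i) = A i"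
    and A_pos_def: "\<And>v. v \<noteq> 0 \<Longrightarrow> v \<bullet> (avg n A *v v) > 0"
    and u_orthonormal: "\<And>i j. u i \<bullet> u j = (if i = j then 1 else 0)"
    and u_eigen: "\<And>i. avg n A *v u i = lam i *\<^sub>R u i"
    and lam_pos: "\<And>i. lam i > 0"
    and M_prob: "prob_space M"
    and J_indep: "prob_space.indep_vars M (\<lambda>_. count_space {1..n}) J UNIV"
    and J_uniform: "\<And>k. distr M (count_space {1..n}) (J k) = uniform_count_measure {1..n}"
  shows
    "(\<forall>l \<epsilon>. l > 0 \<longrightarrow> \<gamma> * l < 2 \<longrightarrow> 0 < \<epsilon> \<longrightarrow> \<epsilon> \<le> 1/2 \<longrightarrow>
        (let \<rho> = (4 * (1 - \<gamma> * l) + \<gamma>\<^sup>2 * l\<^sup>2) / (\<gamma>\<^sup>2 * l\<^sup>2);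
             F = (\<lambda>x. arctan (tan (x / 2) / sqrt \<rho>))
         in ((\<lambda>f::real. cmod (exp (- 4 * pi * \<i> * f) - exp (- 2 * pi * \<i> * f) * (1 - \<gamma> * l)) powi (- 2))
              has_integral
              ((F (pi * (1 - 2 * \<epsilon>)) - F (- pi * (1 - 2 * \<epsilon>))) / (pi * \<gamma> * l * (2 - \<gamma> * l))))
              {\<epsilon>..1 - \<epsilon>}))
     \<and> (\<forall>i. (1 - \<gamma> * lam i)\<^sup>2 = momentum_discriminant 0 \<gamma> (lam i)
          \<and> rho_plus 0 \<gamma> (lam i) (1 - \<gamma> * lam i)
              = (2 + \<gamma>\<^sup>2 * (lam i)\<^sup>2 - 2 * \<gamma> * lam i + 2 * (1 - \<gamma> * lam i)) / (\<gamma>\<^sup>2 * (lam i)\<^sup>2)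
          \<and> rho_plus 0 \<gamma> (lam i) (1 - \<gamma> * lam i)
              = (4 * (1 - \<gamma> * lam i) + \<gamma>\<^sup>2 * (lam i)\<^sup>2) / (\<gamma>\<^sup>2 * (lam i)\<^sup>2)
          \<and> rho_minus 0 \<gamma> (lam i) (1 - \<gamma> * lam i)
              = (2 + \<gamma>\<^sup>2 * (lam i)\<^sup>2 - 2 * \<gamma> * lam i - 2 * (1 - \<gamma> * lam i)) / (\<gamma>\<^sup>2 * (lam i)\<^sup>2)
          \<and> rho_minus 0 \<gamma> (lam i) (1 - \<gamma> * lam i) = 1)
     \<and> ((\<forall>i. \<gamma> * lam i < 2) \<longrightarrow>
         (let x = stationary_iterate \<gamma> n A b J
          in (\<forall>k. \<forall>\<omega>\<in>space M.
                x (k + 1) \<omega> = x k \<omega> - \<gamma> *\<^sub>R zeroth_order_grad n A b (J k \<omega>) (x k \<omega>))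
             \<and> (\<forall>k. x k \<in> borel_measurable M \<and> integrable M (\<lambda>\<omega>. (norm (x k \<omega>))\<^sup>2))
             \<and> (\<forall>k. trace (Var M (x k))
                  = \<gamma> * (\<Sum>i\<in>UNIV. (u i \<bullet> (noise_cov n A b *v u i)) * (1 / (lam i * (2 - \<gamma> * lam i)))))))"
proof -
  interpret orthonormal_basis u by unfold_locales (rule u_orthonormal)
  have A: "avg n A = spectral lam" by (rule spectral_eqI) (rule u_eigen)
  have lam_nz: "lam i \<noteq> 0" for i using lam_pos[of i] by simp
  have inv: "avg n A ** matrix_inv (avg n A) = mat 1"
    unfolding A using lam_nz by (simp add: matrix_inv_spectral spectral_mult spectral_const)
  have integral: "let \<rho> = (4 * (1 - \<gamma> * l) + \<gamma>\<^sup>2 * l\<^sup>2) / (\<gamma>\<^sup>2 * l\<^sup>2);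
             F = (\<lambda>x. arctan (tan (x / 2) / sqrt \<rho>))
         in ((\<lambda>f::real. cmod (exp (- 4 * pi * \<i> * f) - exp (- 2 * pi * \<i> * f) * (1 - \<gamma> * l)) powi (- 2))
              has_integral
              ((F (pi * (1 - 2 * \<epsilon>)) - F (- pi * (1 - 2 * \<epsilon>))) / (pi * \<gamma> * l * (2 - \<gamma> * l))))
              {\<epsilon>..1 - \<epsilon>}"
    if "l > 0" "\<gamma> * l < 2" "0 < \<epsilon>" "\<epsilon> \<le> 1/2" for l \<epsilon>
  proof -
    have pos: "\<gamma> * l > 0" using gamma_pos that by simp
    \<comment> \<open>The numerator is the square of \<open>2 - \<gamma> * l\<close>, which is
      positive here, so the square root needs no absolute value.\<close>
    have "(4 * (1 - \<gamma> * l) + \<gamma>\<^sup>2 * l\<^sup>2) / (\<gamma>\<^sup>2 * l\<^sup>2) = ((1 + (1 - \<gamma> * l)) / (1 - (1 - \<gamma> * l)))\<^sup>2"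
      using gamma_pos that by (simp add: power2_eq_square field_simps)
    then have rho: "sqrt ((4 * (1 - \<gamma> * l) + \<gamma>\<^sup>2 * l\<^sup>2) / (\<gamma>\<^sup>2 * l\<^sup>2)) = (1 + (1 - \<gamma> * l)) / (1 - (1 - \<gamma> * l))"
      using pos that by (simp add: real_sqrt_abs)
    have den: "pi * \<gamma> * l * (2 - \<gamma> * l) = pi * (1 - (1 - \<gamma> * l)\<^sup>2)"
      by (simp add: power2_eq_square algebra_simps)
    have a: "\<bar>1 - \<gamma> * l\<bar> < 1" using pos that by (auto simp: abs_if)
    show ?thesis
      using has_integral_inverse_square_modulus[OF a that(3,4)] unfolding Let_def rho den by simp
  qed
  have a: "\<bar>1 - \<gamma> * lam i\<bar> < 1" if "\<forall>i. \<gamma> * lam i < 2" for i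
    using that[rule_format, of i] mult_pos_pos[OF gamma_pos lam_pos[of i]] by (auto simp: abs_if)
  have recursion: "stationary_iterate \<gamma> n A b J (k + 1) \<omega> = stationary_iterate \<gamma> n A b J k \<omega>
      - \<gamma> *\<^sub>R zeroth_order_grad n A b (J k \<omega>) (stationary_iterate \<gamma> n A b J k \<omega>)"
    if "\<forall>i. \<gamma> * lam i < 2" "\<omega> \<in> space M" for k \<omega>
  proof (rule stationary_iterate_recursion[OF A a[OF that(1)] inv])
    have "J j \<in> measurable M (count_space {1..n})" for j
      using J_indep by (auto simp: prob_space.indep_vars_def[OF M_prob])
    from measurable_space[OF this that(2)] show "J j \<omega> \<in> {1..n}" for j by simp
  qed
  \<comment> \<open>One of the two factors \<gamma> cancels against the stability factor
    \<open>1 - a_i^2\<close>.\<close>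
  have "\<gamma>\<^sup>2 * (q / (1 - (1 - \<gamma> * lam i)\<^sup>2)) = \<gamma> * (q * (1 / (lam i * (2 - \<gamma> * lam i))))" for i q
  proof -
    have "1 - (1 - \<gamma> * lam i)\<^sup>2 = \<gamma> * (lam i * (2 - \<gamma> * lam i))"
      by (simp add: power2_eq_square algebra_simps)
    then show ?thesis using gamma_pos by (simp add: power2_eq_square)
  qed
  then have variance: "trace (Var M (stationary_iterate \<gamma> n A b J k))
      = \<gamma> * (\<Sum>i\<in>UNIV. (u i \<bullet> (noise_cov n A b *v u i)) * (1 / (lam i * (2 - \<gamma> * lam i))))"
    if "\<forall>i. \<gamma> * lam i < 2" for k
    using trace_Var_stationary_iterate(3)[OF A a[OF that] inv M_prob J_indep J_uniform, of b k]
    by (simp add: sum_distrib_left)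
  have rho: "(1 - \<gamma> * lam i)\<^sup>2 = momentum_discriminant 0 \<gamma> (lam i)
      \<and> rho_plus 0 \<gamma> (lam i) (1 - \<gamma> * lam i)
          = (2 + \<gamma>\<^sup>2 * (lam i)\<^sup>2 - 2 * \<gamma> * lam i + 2 * (1 - \<gamma> * lam i)) / (\<gamma>\<^sup>2 * (lam i)\<^sup>2)
      \<and> rho_plus 0 \<gamma> (lam i) (1 - \<gamma> * lam i)
          = (4 * (1 - \<gamma> * lam i) + \<gamma>\<^sup>2 * (lam i)\<^sup>2) / (\<gamma>\<^sup>2 * (lam i)\<^sup>2)
      \<and> rho_minus 0 \<gamma> (lam i) (1 - \<gamma> * lam i)
          = (2 + \<gamma>\<^sup>2 * (lam i)\<^sup>2 - 2 * \<gamma> * lam i - 2 * (1 - \<gamma> * lam i)) / (\<gamma>\<^sup>2 * (lam i)\<^sup>2)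
      \<and> rho_minus 0 \<gamma> (lam i) (1 - \<gamma> * lam i) = 1" for i
    using gamma_pos lam_nz[of i]
    by (simp add: momentum_discriminant_def rho_plus_def rho_minus_def power2_eq_square algebra_simps)
  show ?thesis
    \<comment> \<open>Only the abbreviation of the iterates is unfolded; the other
      \<open>let\<close> must stay folded to match \<open>integral\<close>.\<close>
    unfolding Let_def[where s = "stationary_iterate \<gamma> n A b J"]
    by (intro conjI allI impI ballI integral recursion variance
        trace_Var_stationary_iterate(1,2)[OF A a inv M_prob J_indep J_uniform]
        conjunct1[OF rho] conjunct2[OF rho, THEN conjunct1] conjunct2[OF rho, THEN conjunct2, THEN conjunct1]
        conjunct2[OF rho, THEN conjunct2, THEN conjunct2, THEN conjunct1]
        conjunct2[OF rho, THEN conjunct2, THEN conjunct2, THEN conjunct2]) blast+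
qed

end
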